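(* Let $W$ be a finite Coxeter group and $M_1=M_1(W)$ the Borel submonoid of its biHecke monoid. For $f,g\in M_1$, define $f\le g$ if $w.f\le_B w.g$ for all $w\in W$. Then $\le$ defines a partial order on $M_1$ such that $fg\le f$ and $fg\le g$ for any $f,g\in M_1$.
   Context: $W$ is a finite Coxeter group with simple reflections $(s_i)_{i\in I}$, identity $1$, length $\ell$; $D_R(w)=\{i:\ell(ws_i)<\ell(w)\}$. The biHecke monoid $M(W)$ is the monoid of functions $W\to W$, acting on the right ($w.(fg)=(w.f).g$), generated by $\pi_i,\overline\pi_i$ ($i\in I$), where $w.\pi_i=w$ if $i\in D_R(w)$ and $ws_i$ otherwise; $w.\overline\pi_i=ws_i$ if $i\in D_R(w)$ and $w$ otherwise. $M_1(W)=\{f\in M(W):1.f=1\}$. $\le_B$ is Bruhat order on $W$: $u\le_B v$ if some reduced word of $u$ is a subword of some reduced word of $v$. *)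

theory Defs
  imports "HOL-Algebra.Generated_Groups" "HOL-Library.Sublist"
begin

definition word_prod :: "('a, 'b) monoid_scheme \<Rightarrow> ('i \<Rightarrow> 'a) \<Rightarrow> 'i list \<Rightarrow> 'a" where
  "word_prod W s xs = foldr (\<lambda>i x. s i \<otimes>\<^bsub>W\<^esub> x) xs \<one>\<^bsub>W\<^esub>"

text \<open>
  The congruence on words over \<open>I\<close> generated by the relations \<open>(i j)\<^bsup>m(i,j)\<^esup> = 1\<close>.
  The value \<open>m i j = 0\<close> encodes \<open>m(i,j) = \<infinity>\<close>: the relation is then vacuous. Since \<open>m i i = 1\<close> in
  a Coxeter matrix, every letter is its own inverse modulo the congruence, so the quotient monoid of
  words is the group presented by these generators and relations; no free group is needed.
\<close>

inductive coxeter_cong :: "'i set \<Rightarrow> ('i \<Rightarrow> 'i \<Rightarrow> nat) \<Rightarrow> 'i list \<Rightarrow> 'i list \<Rightarrow> bool"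
  for I m where
  rel: "i \<in> I \<Longrightarrow> j \<in> I \<Longrightarrow> coxeter_cong I m (concat (replicate (m i j) [i, j])) []"
| refl: "u \<in> lists I \<Longrightarrow> coxeter_cong I m u u"
| sym: "coxeter_cong I m u v \<Longrightarrow> coxeter_cong I m v u"
| trans: "coxeter_cong I m u v \<Longrightarrow> coxeter_cong I m v w \<Longrightarrow> coxeter_cong I m u w"
| append: "coxeter_cong I m u v \<Longrightarrow> coxeter_cong I m u' v' \<Longrightarrow> coxeter_cong I m (u @ u') (v @ v')"

locale coxeter_system = group W for W (structure) +
  fixes I :: "'i set" and s :: "'i \<Rightarrow> 'a" and m :: "'i \<Rightarrow> 'i \<Rightarrow> nat"
  assumes m_diag: "i \<in> I \<Longrightarrow> m i i = 1"
    and m_sym: "i \<in> I \<Longrightarrow> j \<in> I \<Longrightarrow> m i j = m j i"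
    and m_offdiag: "i \<in> I \<Longrightarrow> j \<in> I \<Longrightarrow> i \<noteq> j \<Longrightarrow> m i j = 0 \<or> m i j \<ge> 2"
    and s_closed: "i \<in> I \<Longrightarrow> s i \<in> carrier W"
    and s_generate: "generate W (s ` I) = carrier W"
    and presentation: "u \<in> lists I \<Longrightarrow> v \<in> lists I \<Longrightarrow>
      word_prod W s u = word_prod W s v \<longleftrightarrow> coxeter_cong I m u v"

definition cox_length :: "('a, 'b) monoid_scheme \<Rightarrow> 'i set \<Rightarrow> ('i \<Rightarrow> 'a) \<Rightarrow> 'a \<Rightarrow> nat" where
  "cox_length W I s w = (LEAST n. \<exists>xs \<in> lists I. length xs = n \<and> word_prod W s xs = w)"

definition reduced_word ::
    "('a, 'b) monoid_scheme \<Rightarrow> 'i set \<Rightarrow> ('i \<Rightarrow> 'a) \<Rightarrow> 'i list \<Rightarrow> 'a \<Rightarrow> bool" where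
  "reduced_word W I s xs w \<longleftrightarrow>
     xs \<in> lists I \<and> word_prod W s xs = w \<and> length xs = cox_length W I s w"

definition right_descents :: "('a, 'b) monoid_scheme \<Rightarrow> 'i set \<Rightarrow> ('i \<Rightarrow> 'a) \<Rightarrow> 'a \<Rightarrow> 'i set" where
  "right_descents W I s w = {i \<in> I. cox_length W I s (w \<otimes>\<^bsub>W\<^esub> s i) < cox_length W I s w}"

definition bruhat_le ::
    "('a, 'b) monoid_scheme \<Rightarrow> 'i set \<Rightarrow> ('i \<Rightarrow> 'a) \<Rightarrow> 'a \<Rightarrow> 'a \<Rightarrow> bool" where
  "bruhat_le W I s u v \<longleftrightarrow>
     (\<exists>xs ys. reduced_word W I s xs u \<and> reduced_word W I s ys v \<and> subseq xs ys)"

text \<open>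
  A map \<open>W \<rightarrow> W\<close> is represented by a HOL function that is extensional on \<open>carrier W\<close>, so that
  equality of HOL functions is equality of maps. The image \<open>w.f\<close> is written \<open>f w\<close>,
  so the product \<open>fg\<close> of the right action, \<open>w.(fg) = (w.f).g\<close>, is composition in reverse order.
\<close>

definition hecke_pi ::
    "('a, 'b) monoid_scheme \<Rightarrow> 'i set \<Rightarrow> ('i \<Rightarrow> 'a) \<Rightarrow> 'i \<Rightarrow> ('a \<Rightarrow> 'a)" where
  "hecke_pi W I s i =
     (\<lambda>w \<in> carrier W. if i \<in> right_descents W I s w then w else w \<otimes>\<^bsub>W\<^esub> s i)"

definition hecke_pi_bar ::
    "('a, 'b) monoid_scheme \<Rightarrow> 'i set \<Rightarrow> ('i \<Rightarrow> 'a) \<Rightarrow> 'i \<Rightarrow> ('a \<Rightarrow> 'a)" where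
  "hecke_pi_bar W I s i =
     (\<lambda>w \<in> carrier W. if i \<in> right_descents W I s w then w \<otimes>\<^bsub>W\<^esub> s i else w)"

definition rcomp :: "('a, 'b) monoid_scheme \<Rightarrow> ('a \<Rightarrow> 'a) \<Rightarrow> ('a \<Rightarrow> 'a) \<Rightarrow> ('a \<Rightarrow> 'a)" where
  "rcomp W f g = compose (carrier W) g f"

inductive_set bihecke_set ::
    "('a, 'b) monoid_scheme \<Rightarrow> 'i set \<Rightarrow> ('i \<Rightarrow> 'a) \<Rightarrow> ('a \<Rightarrow> 'a) set"
  for W I s where
  one: "(\<lambda>w \<in> carrier W. w) \<in> bihecke_set W I s"
| pi: "i \<in> I \<Longrightarrow> hecke_pi W I s i \<in> bihecke_set W I s"
| pi_bar: "i \<in> I \<Longrightarrow> hecke_pi_bar W I s i \<in> bihecke_set W I s"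
| mult: "f \<in> bihecke_set W I s \<Longrightarrow> g \<in> bihecke_set W I s \<Longrightarrow> rcomp W f g \<in> bihecke_set W I s"

definition bihecke_monoid ::
    "('a, 'b) monoid_scheme \<Rightarrow> 'i set \<Rightarrow> ('i \<Rightarrow> 'a) \<Rightarrow> ('a \<Rightarrow> 'a) monoid" where
  "bihecke_monoid W I s =
     \<lparr>carrier = bihecke_set W I s, mult = rcomp W, one = (\<lambda>w \<in> carrier W. w)\<rparr>"

definition borel_submonoid ::
    "('a, 'b) monoid_scheme \<Rightarrow> 'i set \<Rightarrow> ('i \<Rightarrow> 'a) \<Rightarrow> ('a \<Rightarrow> 'a) set" where
  "borel_submonoid W I s = {f \<in> carrier (bihecke_monoid W I s). f \<one>\<^bsub>W\<^esub> = \<one>\<^bsub>W\<^esub>}"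

definition borel_order ::
    "('a, 'b) monoid_scheme \<Rightarrow> 'i set \<Rightarrow> ('i \<Rightarrow> 'a) \<Rightarrow> (('a \<Rightarrow> 'a) \<times> ('a \<Rightarrow> 'a)) set" where
  "borel_order W I s =
     {(f, g). f \<in> borel_submonoid W I s \<and> g \<in> borel_submonoid W I s \<and>
              (\<forall>w \<in> carrier W. bruhat_le W I s (f w) (g w))}"

end

theory Submission
  imports Defs
begin

text \<open>
  Two facts about the biHecke monoid carry the proof: every \<open>f\<close> in \<open>M(W)\<close> preserves Bruhat order,
  and every \<open>f\<close> in \<open>M\<^sub>1(W)\<close> is regressive, \<open>w.f \<le>\<^sub>B w\<close>. Given these, \<open>w.(fg) = (w.f).g \<le>\<^sub>B w.f\<close>
  because \<open>g\<close> is regressive, and \<open>(w.f).g \<le>\<^sub>B w.g\<close> because \<open>f\<close> is regressive and \<open>g\<close> preserves the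
  order. That \<open>\<le>\<close> is a partial order on \<open>M\<^sub>1(W)\<close> is inherited pointwise from Bruhat order.

  Regressivity comes from the left side. A generator, acting on the right, sends \<open>w\<close> and \<open>s\<^sub>j w\<close> to
  elements that agree or still differ by \<open>s\<^sub>j\<close> on the left (\<open>bihecke_left_step\<close>). Peeling letters off
  a word of \<open>w\<close>, the element \<open>w.f\<close> is therefore the product of a subword, times \<open>1.f = 1\<close>.

  The rest is Bruhat order itself. From the presentation, the parity of the number of times that
  a group element occurs among the reflections attached to a word depends only on the product of the
  word (\<open>coxeter_cong_inversion_parity\<close>). This gives the strong exchange property
  (\<open>strong_exchange\<close>). With it, the subword order is identified with the reflexive transitive
  closure of ``multiply by a reflection and get longer'' (\<open>bruhat_le_iff_chain\<close>); for the latter,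
  transitivity, antisymmetry and monotonicity of the generators can be checked edge by edge.
\<close>

context coxeter_system
begin

abbreviation wp :: "'i list \<Rightarrow> 'a" where
  "wp \<equiv> word_prod W s"

abbreviation len :: "'a \<Rightarrow> nat" where
  "len \<equiv> cox_length W I s"

section \<open>Words and length\<close>

lemma wp_Nil [simp]: "wp [] = \<one>"
  and wp_Cons [simp]: "wp (i # xs) = s i \<otimes> wp xs"
  by (simp_all add: word_prod_def)

lemma wp_closed [simp, intro]: "xs \<in> lists I \<Longrightarrow> wp xs \<in> carrier W"
  by (induction xs) (auto simp: s_closed)

lemma wp_append: "xs \<in> lists I \<Longrightarrow> ys \<in> lists I \<Longrightarrow> wp (xs @ ys) = wp xs \<otimes> wp ys"
  by (induction xs) (auto simp: s_closed m_assoc)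

lemma s_s: "i \<in> I \<Longrightarrow> s i \<otimes> s i = \<one>"
  using presentation[of "[i, i]" "[]"] coxeter_cong.rel[of i I i m]
  by (simp add: m_diag s_closed)

lemma inv_s: "i \<in> I \<Longrightarrow> inv (s i) = s i"
  by (simp add: inv_equality s_s s_closed)

lemma s_cancel_right: "i \<in> I \<Longrightarrow> w \<in> carrier W \<Longrightarrow> w \<otimes> s i \<otimes> s i = w"
  by (simp add: m_assoc s_closed s_s)

lemma s_cancel_left: "i \<in> I \<Longrightarrow> w \<in> carrier W \<Longrightarrow> s i \<otimes> (s i \<otimes> w) = w"
  by (simp add: m_assoc[symmetric] s_closed s_s)

lemma inv_cancel_left: "x \<in> carrier W \<Longrightarrow> w \<in> carrier W \<Longrightarrow> inv x \<otimes> (x \<otimes> w) = w"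
  by (simp add: m_assoc[symmetric])

lemma wp_rev: "xs \<in> lists I \<Longrightarrow> wp (rev xs) = inv (wp xs)"
proof (induction xs)
  case (Cons i xs)
  then have "rev xs \<in> lists I" "[i] \<in> lists I" by auto
  then show ?case using Cons s_closed by (simp add: wp_append inv_mult_group inv_s)
qed simp

lemma ex_word:
  assumes "w \<in> carrier W"
  obtains xs where "xs \<in> lists I" "wp xs = w"
proof -
  have "w \<in> generate W (s ` I)"
    using assms s_generate by simp
  then have "\<exists>xs \<in> lists I. wp xs = w"
  proof induction
    case one
    then show ?case by (intro bexI[of _ "[]"]) auto
  next
    case (incl h)
    then obtain i where "i \<in> I" "h = s i" by auto
    then show ?case by (intro bexI[of _ "[i]"]) (auto simp: s_closed)
  next
    case (inv h)
    then obtain i where "i \<in> I" "h = s i" by auto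
    then show ?case by (intro bexI[of _ "[i]"]) (auto simp: s_closed inv_s)
  next
    case (eng h1 h2)
    then obtain xs ys where "xs \<in> lists I" "wp xs = h1" "ys \<in> lists I" "wp ys = h2" by auto
    then show ?case by (intro bexI[of _ "xs @ ys"]) (auto simp: wp_append)
  qed
  then show thesis using that by blast
qed

lemma len_le: "xs \<in> lists I \<Longrightarrow> len (wp xs) \<le> length xs"
  unfolding cox_length_def by (rule Least_le) auto

lemma ex_reduced_word:
  assumes "w \<in> carrier W"
  obtains xs where "xs \<in> lists I" "wp xs = w" "length xs = len w"
proof -
  obtain ys where "ys \<in> lists I" "wp ys = w" using ex_word[OF assms] .
  then have "\<exists>n. \<exists>xs \<in> lists I. length xs = n \<and> wp xs = w" by blast
  from LeastI_ex[OF this] show thesis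
    using that unfolding cox_length_def by blast
qed

lemma len_mult_s_le:
  assumes "w \<in> carrier W" "i \<in> I"
  shows "len (w \<otimes> s i) \<le> Suc (len w)"
proof -
  obtain xs where xs: "xs \<in> lists I" "wp xs = w" "length xs = len w"
    using ex_reduced_word[OF assms(1)] .
  then have "wp (xs @ [i]) = w \<otimes> s i" using assms s_closed by (simp add: wp_append)
  then show ?thesis using len_le[of "xs @ [i]"] xs assms by simp
qed

text \<open>Both sides of every defining relation have even length.\<close>

lemma coxeter_cong_length_parity: "coxeter_cong I m u v \<Longrightarrow> even (length u) = even (length v)"
proof (induction rule: coxeter_cong.induct)
  case (rel i j)
  have "even (length (concat (replicate k [i, j])))" for k
    by (induction k) auto
  then show ?case by simp
qed auto

lemma even_len_wp:
  assumes "xs \<in> lists I"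
  shows "even (len (wp xs)) = even (length xs)"
proof -
  obtain ys where ys: "ys \<in> lists I" "wp ys = wp xs" "length ys = len (wp xs)"
    using ex_reduced_word[of "wp xs"] assms by blast
  then have "coxeter_cong I m ys xs" using presentation assms by blast
  then show ?thesis using coxeter_cong_length_parity ys by fastforce
qed

section \<open>Inversions of a word and strong exchange\<close>

text \<open>
  The reflections attached to a word \<open>i\<^sub>1\<dots>i\<^sub>k\<close> are \<open>x\<inverse> s x\<close>, where \<open>s\<close> is a letter and \<open>x\<close> the
  product of the letters after it. Multiplying the product of the word by such a reflection on the
  right deletes that letter. The test \<open>x t = s x\<close> avoids inverses.
\<close>

primrec inversion_count :: "'i list \<Rightarrow> 'a \<Rightarrow> nat" where
  "inversion_count [] t = 0"
| "inversion_count (i # xs) t = of_bool (wp xs \<otimes> t = s i \<otimes> wp xs) + inversion_count xs t"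

lemma inversion_count_append:
  assumes "xs \<in> lists I" "ys \<in> lists I" "t \<in> carrier W"
  shows "inversion_count (xs @ ys) t =
    inversion_count xs (wp ys \<otimes> t \<otimes> inv (wp ys)) + inversion_count ys t"
  using assms(1)
proof (induction xs)
  case (Cons i xs)
  then have c: "i \<in> I" "xs \<in> lists I" "s i \<in> carrier W" "wp xs \<in> carrier W" "wp ys \<in> carrier W"
    using assms s_closed by auto
  have "wp xs \<otimes> wp ys \<otimes> t = (wp xs \<otimes> (wp ys \<otimes> t \<otimes> inv (wp ys))) \<otimes> wp ys"
    using c assms(3) by (simp add: m_assoc)
  moreover have "s i \<otimes> (wp xs \<otimes> wp ys) = (s i \<otimes> wp xs) \<otimes> wp ys"
    using c by (simp add: m_assoc)
  ultimately have "wp xs \<otimes> wp ys \<otimes> t = s i \<otimes> (wp xs \<otimes> wp ys) \<longleftrightarrow>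
      wp xs \<otimes> (wp ys \<otimes> t \<otimes> inv (wp ys)) = s i \<otimes> wp xs"
    using c assms(3) by simp
  then show ?case using Cons c assms by (simp add: wp_append)
qed simp

lemma inversion_count_delete:
  assumes "xs \<in> lists I" "t \<in> carrier W" "inversion_count xs t \<noteq> 0"
  shows "\<exists>ys i zs. xs = ys @ i # zs \<and> wp (ys @ zs) = wp xs \<otimes> t"
  using assms(1,3)
proof (induction xs)
  case (Cons i xs)
  then have c: "i \<in> I" "xs \<in> lists I" "s i \<in> carrier W" "wp xs \<in> carrier W"
    using s_closed by auto
  show ?case
  proof (cases "wp xs \<otimes> t = s i \<otimes> wp xs")
    case True
    then have "wp xs = wp (i # xs) \<otimes> t"
      using c assms(2) by (simp add: m_assoc s_cancel_left)
    then show ?thesis by (intro exI[of _ "[]"] exI[of _ i] exI[of _ xs]) simp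
  next
    case False
    then obtain ys j zs where "xs = ys @ j # zs" "wp (ys @ zs) = wp xs \<otimes> t"
      using Cons c by auto
    then show ?thesis
      using c assms(2) by (intro exI[of _ "i # ys"] exI[of _ j] exI[of _ zs]) (simp add: m_assoc)
  qed
qed simp

lemma wp_alternating:
  assumes "i \<in> I" "j \<in> I"
  shows "wp (concat (replicate k [i, j])) = (s i \<otimes> s j) [^] k"
proof (induction k)
  case (Suc k)
  have "(s i \<otimes> s j) [^] Suc k = (s i \<otimes> s j) \<otimes> (s i \<otimes> s j) [^] k"
    using assms s_closed by (intro nat_pow_Suc2) auto
  then show ?case using Suc assms s_closed by (simp add: m_assoc)
qed simp

lemma s_alternating_commute:
  assumes "i \<in> I" "j \<in> I"
  shows "(s i \<otimes> s j) [^] (k::nat) \<otimes> (s j \<otimes> (s i \<otimes> s j) [^] k) = s j"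
proof (induction k)
  case 0
  then show ?case using assms s_closed by simp
next
  case (Suc k)
  let ?p = "s i \<otimes> s j"
  have c: "s i \<in> carrier W" "s j \<in> carrier W" "?p [^] k \<in> carrier W"
    using assms s_closed by auto
  have "?p [^] Suc k = ?p \<otimes> ?p [^] k"
    using c by (intro nat_pow_Suc2) auto
  then have "?p [^] Suc k \<otimes> (s j \<otimes> ?p [^] Suc k)
      = ?p [^] k \<otimes> ?p \<otimes> (s j \<otimes> (?p \<otimes> ?p [^] k))" by simp
  also have "\<dots> = ?p [^] k \<otimes> (s i \<otimes> (s j \<otimes> (s j \<otimes> (s i \<otimes> (s j \<otimes> ?p [^] k)))))"
    using c by (simp add: m_assoc)
  also have "\<dots> = ?p [^] k \<otimes> (s j \<otimes> ?p [^] k)"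
    using c assms by (simp add: s_cancel_left)
  finally show ?case using Suc by simp
qed

text \<open>
  Read from the right, the reflections of the alternating word \<open>(i j)\<^sup>k\<close> are \<open>p\<^sup>-\<^sup>q s\<^sub>j\<close> for \<open>q < 2k\<close>,
  with \<open>p = s\<^sub>i s\<^sub>j\<close>.
\<close>

lemma inversion_count_alternating:
  assumes "i \<in> I" "j \<in> I" "t \<in> carrier W"
  shows "inversion_count (concat (replicate k [i, j])) t =
    (\<Sum>q<2 * k. of_bool ((s i \<otimes> s j) [^] q \<otimes> t = s j))"
proof (induction k)
  case (Suc k)
  let ?p = "s i \<otimes> s j"
  let ?x = "concat (replicate k [i, j])"
  have c: "s i \<in> carrier W" "s j \<in> carrier W" "?p [^] k \<in> carrier W" "?p \<in> carrier W"
    using assms s_closed by auto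
  have x: "wp ?x = ?p [^] k" by (rule wp_alternating[OF assms(1,2)])
  have even_pow: "?p [^] (2 * k) = ?p [^] k \<otimes> ?p [^] k"
    using c by (simp add: nat_pow_mult mult_2)
  have odd_pow: "?p [^] Suc (2 * k) = ?p [^] k \<otimes> (?p \<otimes> ?p [^] k)"
  proof -
    have "?p [^] Suc (2 * k) = ?p [^] k \<otimes> ?p [^] Suc k"
      using c by (subst nat_pow_mult) (auto simp: mult_2)
    also have "?p [^] Suc k = ?p \<otimes> ?p [^] k"
      using c by (intro nat_pow_Suc2) auto
    finally show ?thesis .
  qed
  have "?p [^] k \<otimes> t = s j \<otimes> ?p [^] k \<longleftrightarrow>
      ?p [^] k \<otimes> (?p [^] k \<otimes> t) = ?p [^] k \<otimes> (s j \<otimes> ?p [^] k)"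
    using c assms by simp
  also have "\<dots> \<longleftrightarrow> ?p [^] (2 * k) \<otimes> t = s j"
    using c assms s_alternating_commute[of i j k] by (simp add: even_pow m_assoc)
  finally have e: "?p [^] k \<otimes> t = s j \<otimes> ?p [^] k \<longleftrightarrow> ?p [^] (2 * k) \<otimes> t = s j" .
  have "s j \<otimes> ?p [^] k \<otimes> t = s i \<otimes> (s j \<otimes> ?p [^] k) \<longleftrightarrow>
      ?p [^] k \<otimes> (s i \<otimes> (s j \<otimes> ?p [^] k \<otimes> t))
        = ?p [^] k \<otimes> (s i \<otimes> (s i \<otimes> (s j \<otimes> ?p [^] k)))"
    using c assms by simp
  also have "\<dots> \<longleftrightarrow> ?p [^] Suc (2 * k) \<otimes> t = s j"
    unfolding odd_pow using c assms s_alternating_commute[of i j k]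
    by (simp add: m_assoc s_cancel_left)
  finally have o: "s j \<otimes> ?p [^] k \<otimes> t = s i \<otimes> (s j \<otimes> ?p [^] k) \<longleftrightarrow>
      ?p [^] Suc (2 * k) \<otimes> t = s j" .
  have "inversion_count (concat (replicate (Suc k) [i, j])) t =
      of_bool (s j \<otimes> ?p [^] k \<otimes> t = s i \<otimes> (s j \<otimes> ?p [^] k)) +
      (of_bool (?p [^] k \<otimes> t = s j \<otimes> ?p [^] k) + inversion_count ?x t)"
    by (simp add: x)
  also have "\<dots> = of_bool (?p [^] Suc (2 * k) \<otimes> t = s j) +
      (of_bool (?p [^] (2 * k) \<otimes> t = s j) + (\<Sum>q<2 * k. of_bool (?p [^] q \<otimes> t = s j)))"
    by (simp only: e o Suc)
  also have "\<dots> = (\<Sum>q<2 * Suc k. of_bool (?p [^] q \<otimes> t = s j))"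
    by simp
  finally show ?case .
qed simp

lemma coxeter_cong_lists: "coxeter_cong I m u v \<Longrightarrow> u \<in> lists I \<and> v \<in> lists I"
proof (induction rule: coxeter_cong.induct)
  case (rel i j)
  then show ?case by (auto simp: in_lists_conv_set)
qed auto

text \<open>
  For a defining relation the \<open>2m\<close> reflections repeat with period \<open>m\<close>, because \<open>p\<^sup>m = 1\<close>, so each
  occurs an even number of times. The cocycle rule \<open>inversion_count_append\<close> propagates this through
  the congruence.
\<close>

lemma coxeter_cong_inversion_parity:
  "coxeter_cong I m u v \<Longrightarrow> t \<in> carrier W \<Longrightarrow>
    even (inversion_count u t) = even (inversion_count v t)"
proof (induction arbitrary: t rule: coxeter_cong.induct)
  case (rel i j)
  let ?p = "s i \<otimes> s j"
  let ?A = "\<lambda>q. of_bool (?p [^] q \<otimes> t = s j) :: nat"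
  let ?r = "concat (replicate (m i j) [i, j])"
  have "coxeter_cong I m ?r []" using rel by (intro coxeter_cong.rel) auto
  then have "wp ?r = wp []" using presentation coxeter_cong_lists by blast
  then have one: "?p [^] m i j = \<one>" using rel wp_alternating by simp
  have c: "?p \<in> carrier W" using rel s_closed by simp
  have period: "?A (m i j + q) = ?A q" for q
    using one c by (simp add: nat_pow_mult[symmetric])
  have split: "(\<Sum>q<n + k. f q) = (\<Sum>q<n. f q) + (\<Sum>q<k. f (n + q))" for f :: "nat \<Rightarrow> nat" and n k
    by (induction k) auto
  have "inversion_count ?r t = (\<Sum>q<m i j + m i j. ?A q)"
    using inversion_count_alternating rel by (simp add: mult_2)
  also have "\<dots> = 2 * (\<Sum>q<m i j. ?A q)"
    by (simp only: split period mult_2)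
  finally show ?case by simp
next
  case (append u v u' v')
  have l: "u \<in> lists I" "v \<in> lists I" "u' \<in> lists I" "v' \<in> lists I"
    using append coxeter_cong_lists by auto
  have "wp u' = wp v'" using append l presentation by blast
  then show ?case using append l by (simp add: inversion_count_append)
qed auto

definition reflections :: "'a set" where
  "reflections = {x \<otimes> s i \<otimes> inv x | x i. x \<in> carrier W \<and> i \<in> I}"

lemma reflections_closed: "t \<in> reflections \<Longrightarrow> t \<in> carrier W"
  by (auto simp: reflections_def s_closed)

lemma s_reflection: "i \<in> I \<Longrightarrow> s i \<in> reflections"
  unfolding reflections_def using s_closed by (force intro: exI[of _ "\<one>"])

lemma reflection_conj:
  assumes "t \<in> reflections" "y \<in> carrier W"
  shows "y \<otimes> t \<otimes> inv y \<in> reflections"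
proof -
  obtain x i where x: "x \<in> carrier W" "i \<in> I" "t = x \<otimes> s i \<otimes> inv x"
    using assms unfolding reflections_def by blast
  then have "y \<otimes> t \<otimes> inv y = (y \<otimes> x) \<otimes> s i \<otimes> inv (y \<otimes> x)"
    using assms s_closed by (simp add: m_assoc inv_mult_group)
  then show ?thesis using x assms unfolding reflections_def by blast
qed

lemma reflection_square:
  assumes "t \<in> reflections"
  shows "t \<otimes> t = \<one>"
proof -
  obtain x i where x: "x \<in> carrier W" "i \<in> I" "t = x \<otimes> s i \<otimes> inv x"
    using assms unfolding reflections_def by blast
  then have "t \<otimes> t = x \<otimes> (s i \<otimes> (inv x \<otimes> (x \<otimes> (s i \<otimes> inv x))))"
    using s_closed by (simp add: m_assoc)
  also have "\<dots> = \<one>"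
    using x s_closed by (simp add: inv_cancel_left s_cancel_left)
  finally show ?thesis .
qed

text \<open>
  A reflection is an inversion of its own palindromic word \<open>a i a\<inverse>\<close>: without the middle letter the
  counts cancel modulo 2, and the middle letter contributes exactly once.
\<close>

lemma reflection_word:
  assumes "t \<in> reflections"
  obtains xs where "xs \<in> lists I" "wp xs = t" "odd (length xs)" "odd (inversion_count xs t)"
proof -
  obtain x i where x: "x \<in> carrier W" "i \<in> I" "t = x \<otimes> s i \<otimes> inv x"
    using assms unfolding reflections_def by blast
  obtain a where a: "a \<in> lists I" "wp a = x" using ex_word[OF x(1)] .
  have ra: "rev a \<in> lists I" using a by auto
  have t: "t \<in> carrier W" using assms by (rule reflections_closed)
  have c: "s i \<in> carrier W" using x s_closed by simp
  have conj: "inv x \<otimes> t \<otimes> x = s i"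
    using x c by (simp add: m_assoc inv_cancel_left)
  have conj': "s i \<otimes> s i \<otimes> inv (s i) = s i"
    using x c by (simp add: s_s inv_s)
  have wra: "wp (rev a) = inv x" using wp_rev[OF a(1)] a(2) by simp
  have x': "inv (inv x) = x" using x by simp
  have "wp (a @ rev a) = x \<otimes> inv x" by (simp only: wp_append[OF a(1) ra] a(2) wra)
  then have "wp (a @ rev a) = wp []" using x(1) by simp
  then have "coxeter_cong I m (a @ rev a) []" using presentation[of "a @ rev a" "[]"] a ra by auto
  from coxeter_cong_inversion_parity[OF this t]
  have "even (inversion_count (a @ rev a) t)" by simp
  then have ev: "even (inversion_count a (s i) + inversion_count (rev a) t)"
    by (simp only: inversion_count_append[OF a(1) ra t] wra x' conj)
  have ai: "a @ [i] \<in> lists I" "[i] \<in> lists I" using a x by auto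
  have "inversion_count ((a @ [i]) @ rev a) t =
      inversion_count (a @ [i]) (s i) + inversion_count (rev a) t"
    by (simp only: inversion_count_append[OF ai(1) ra t] wra x' conj)
  also have "inversion_count (a @ [i]) (s i) = inversion_count a (s i) + 1"
    using inversion_count_append[OF a(1) ai(2) c] c conj' by simp
  finally have "odd (inversion_count ((a @ [i]) @ rev a) t)" using ev by simp
  moreover have "wp ((a @ [i]) @ rev a) = x \<otimes> (s i \<otimes> \<one>) \<otimes> inv x"
    by (simp only: wp_append[OF ai(1) ra] wp_append[OF a(1) ai(2)] a(2) wra wp_Cons wp_Nil)
  then have "wp ((a @ [i]) @ rev a) = t" using c x(3) by simp
  moreover have "(a @ [i]) @ rev a \<in> lists I" "odd (length ((a @ [i]) @ rev a))"
    using ai ra by auto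
  ultimately show thesis using that by blast
qed

lemma len_reflection_parity:
  assumes "w \<in> carrier W" "t \<in> reflections"
  shows "even (len (w \<otimes> t)) \<longleftrightarrow> odd (len w)"
proof -
  obtain xs where xs: "xs \<in> lists I" "wp xs = w" using ex_word[OF assms(1)] .
  obtain ts where ts: "ts \<in> lists I" "wp ts = t" "odd (length ts)"
    using reflection_word[OF assms(2)] by blast
  have "wp (xs @ ts) = w \<otimes> t" using xs ts by (simp add: wp_append)
  then show ?thesis using even_len_wp[of "xs @ ts"] even_len_wp[of xs] xs ts by auto
qed

text \<open>
  Append a palindromic word of \<open>t\<close> to a reduced word \<open>zs\<close> of \<open>w t\<close>: the result has product \<open>w\<close>, and
  \<open>t\<close> is not an inversion of \<open>zs\<close>, since otherwise deleting a letter of \<open>zs\<close> would give a word of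
  \<open>w\<close> that is too short. So \<open>t\<close> occurs oddly often in one word of \<open>w\<close>, hence in all of them,
  reduced or not.
\<close>

lemma strong_exchange:
  assumes xs: "xs \<in> lists I" and t: "t \<in> reflections" and less: "len (wp xs \<otimes> t) < len (wp xs)"
  shows "\<exists>ys i zs. xs = ys @ i # zs \<and> wp (ys @ zs) = wp xs \<otimes> t"
proof -
  let ?w = "wp xs"
  have tc: "t \<in> carrier W" using t by (rule reflections_closed)
  have w: "?w \<in> carrier W" using xs by simp
  obtain ts where ts: "ts \<in> lists I" "wp ts = t" "odd (inversion_count ts t)"
    using reflection_word[OF t] by blast
  obtain zs where zs: "zs \<in> lists I" "wp zs = ?w \<otimes> t" "length zs = len (?w \<otimes> t)"
    using ex_reduced_word[of "?w \<otimes> t"] w tc by blast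
  have wtt: "?w \<otimes> t \<otimes> t = ?w" using w tc t by (simp add: m_assoc reflection_square)
  have "inversion_count zs t = 0"
  proof (rule ccontr)
    assume "inversion_count zs t \<noteq> 0"
    then obtain as i bs where d: "zs = as @ i # bs" "wp (as @ bs) = ?w"
      using inversion_count_delete[OF zs(1) tc] zs wtt by auto
    then have "len ?w \<le> length (as @ bs)" using zs len_le[of "as @ bs"] by auto
    then show False using d zs less by simp
  qed
  moreover have "wp (zs @ ts) = ?w" using zs ts wtt by (simp add: wp_append)
  then have "coxeter_cong I m (zs @ ts) xs"
    using presentation[of "zs @ ts" xs] zs ts xs by auto
  then have "even (inversion_count (zs @ ts) t) = even (inversion_count xs t)"
    using tc by (rule coxeter_cong_inversion_parity)
  moreover have "t \<otimes> t \<otimes> inv t = t" using tc by (simp add: m_assoc)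
  ultimately have "odd (inversion_count xs t)"
    using zs ts tc by (simp add: inversion_count_append)
  then have "inversion_count xs t \<noteq> 0" by (metis even_zero)
  then show ?thesis using inversion_count_delete[OF xs tc] by blast
qed

lemma subword_delete: "subseq (ys @ zs) (ys @ i # zs)"
  by (intro list_emb_append_mono) auto

lemma subword_lists: "subseq xs ys \<Longrightarrow> ys \<in> lists I \<Longrightarrow> xs \<in> lists I"
  using subseq_order.order_refl by (auto simp: in_lists_conv_set dest: list_emb_set)

text \<open>
  Reduce the word without its last letter first. If appending that letter shortens the product,
  strong exchange removes a letter from the reduced subword instead.
\<close>

lemma ex_reduced_subword:
  "xs \<in> lists I \<Longrightarrow> \<exists>ys. subseq ys xs \<and> reduced_word W I s ys (wp xs)"
proof (induction xs rule: rev_induct)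
  case Nil
  then show ?case using len_le[of "[]"] by (auto simp: reduced_word_def)
next
  case (snoc i xs)
  then have i: "i \<in> I" "xs \<in> lists I" by auto
  then obtain zs where zs: "subseq zs xs" "zs \<in> lists I" "wp zs = wp xs" "length zs = len (wp xs)"
    using snoc by (auto simp: reduced_word_def)
  have e: "wp (xs @ [i]) = wp xs \<otimes> s i" "wp (zs @ [i]) = wp xs \<otimes> s i"
    using i zs s_closed by (auto simp: wp_append)
  have sub: "subseq (zs @ [i]) (xs @ [i])" using zs by simp
  show ?case
  proof (cases "len (wp xs \<otimes> s i) < len (wp xs)")
    case False
    have "len (wp xs \<otimes> s i) \<le> Suc (len (wp xs))"
      using len_mult_s_le i by blast
    moreover have "len (wp xs \<otimes> s i) \<noteq> len (wp xs)"
      using len_reflection_parity[of "wp xs" "s i"] i s_reflection by auto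
    ultimately have "length (zs @ [i]) = len (wp xs \<otimes> s i)" using False zs by simp
    then have "reduced_word W I s (zs @ [i]) (wp (xs @ [i]))"
      using zs i e by (simp add: reduced_word_def)
    then show ?thesis using sub by blast
  next
    case True
    then obtain as j bs where d: "zs = as @ j # bs" "wp (as @ bs) = wp xs \<otimes> s i"
      using strong_exchange[of zs "s i"] zs i s_reflection by auto
    have l: "as @ bs \<in> lists I" using d zs by auto
    \<comment> \<open>Multiplying by \<open>s\<^sub>i\<close> lowers the length by at most one, so the word with one letter deleted is
      reduced.\<close>
    have "len (wp xs \<otimes> s i \<otimes> s i) \<le> Suc (len (wp xs \<otimes> s i))"
      using len_mult_s_le i s_closed by simp
    then have "len (wp xs) \<le> Suc (len (wp xs \<otimes> s i))"
      using i by (simp add: s_cancel_right)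
    moreover have "len (wp xs \<otimes> s i) \<le> length (as @ bs)"
      using len_le[OF l] d by simp
    ultimately have "length (as @ bs) = len (wp xs \<otimes> s i)"
      using d zs by simp
    moreover have "subseq (as @ bs) (xs @ [i])"
      using subword_delete[of as bs j] d zs
      by (metis subseq_order.order_trans subseq_rev_drop_many)
    moreover have "wp (as @ bs) = wp (xs @ [i])" using d e by simp
    ultimately show ?thesis using l e unfolding reduced_word_def by metis
  qed
qed

section \<open>Bruhat order as chains of reflections\<close>

definition bruhat_edge :: "'a \<Rightarrow> 'a \<Rightarrow> bool" where
  "bruhat_edge x y \<longleftrightarrow> x \<in> carrier W \<and> (\<exists>t \<in> reflections. y = x \<otimes> t) \<and> len x < len y"

abbreviation bruhat_chain :: "'a \<Rightarrow> 'a \<Rightarrow> bool" where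
  "bruhat_chain \<equiv> bruhat_edge\<^sup>*\<^sup>*"

lemma bruhat_edge_closed: "bruhat_edge x y \<Longrightarrow> x \<in> carrier W \<and> y \<in> carrier W"
  by (auto simp: bruhat_edge_def reflections_closed)

lemma bruhat_chain_len: "bruhat_chain x y \<Longrightarrow> x = y \<or> len x < len y"
  by (induction rule: rtranclp_induct) (auto simp: bruhat_edge_def)

text \<open>
  Strong exchange holds for words that need not be reduced, so it can be applied again to the
  shortened word at every edge of a chain.
\<close>

lemma bruhat_chain_subword:
  assumes "bruhat_chain x (wp ys)" "ys \<in> lists I"
  shows "\<exists>xs. subseq xs ys \<and> wp xs = x"
  using assms
proof (induction "wp ys" arbitrary: ys rule: rtranclp_induct)
  case base
  then show ?case by (intro exI[of _ ys]) simp
next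
  case (step y)
  then obtain t where t: "y \<in> carrier W" "t \<in> reflections" "wp ys = y \<otimes> t" "len y < len (wp ys)"
    by (auto simp: bruhat_edge_def)
  then have y: "wp ys \<otimes> t = y"
    using reflections_closed[OF t(2)] reflection_square[OF t(2)] by (simp add: m_assoc)
  then obtain as i bs where d: "ys = as @ i # bs" "wp (as @ bs) = y"
    using strong_exchange[OF step(4) t(2)] t(4) by metis
  moreover have "as @ bs \<in> lists I" using d(1) step(4) by simp
  ultimately obtain xs where "subseq xs (as @ bs)" "wp xs = x"
    using step(3)[of "as @ bs"] by blast
  then show ?case using d(1) subword_delete subseq_order.order_trans by metis
qed

text \<open>
  Right multiplication by \<open>s = s\<^sub>i\<close> preserves an edge \<open>x \<rightarrow> y\<close> unless it swaps its ends. The elements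
  \<open>x s\<close> and \<open>y s\<close> differ by a reflection; if \<open>y s\<close> were the shorter one, strong exchange in a
  reduced word of \<open>x\<close> followed by \<open>i\<close> would delete either the last letter, giving \<open>y s = x\<close>, or an
  earlier one, making \<open>y\<close> shorter than \<open>x\<close>.
\<close>

lemma bruhat_edge_mult:
  assumes e: "bruhat_edge x y" and i: "i \<in> I" and ne: "y \<noteq> x \<otimes> s i"
  shows "bruhat_edge (x \<otimes> s i) (y \<otimes> s i)"
proof -
  obtain t where t: "t \<in> reflections" "y = x \<otimes> t" "len x < len y" and x: "x \<in> carrier W"
    using e by (auto simp: bruhat_edge_def)
  have c: "t \<in> carrier W" "s i \<in> carrier W" "y \<in> carrier W"
    using t x i s_closed reflections_closed by auto
  let ?r = "s i \<otimes> t \<otimes> inv (s i)"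
  have r: "?r \<in> reflections" using reflection_conj t c by blast
  have "x \<otimes> s i \<otimes> ?r = x \<otimes> (s i \<otimes> (s i \<otimes> (t \<otimes> s i)))"
    using x c i by (simp add: m_assoc inv_s)
  also have "\<dots> = y \<otimes> s i"
    using x c i t by (simp add: s_cancel_left m_assoc)
  finally have ys: "x \<otimes> s i \<otimes> ?r = y \<otimes> s i" .
  have "\<not> len (y \<otimes> s i) < len (x \<otimes> s i)"
  proof
    assume less: "len (y \<otimes> s i) < len (x \<otimes> s i)"
    obtain xs where xs: "xs \<in> lists I" "wp xs = x" "length xs = len x"
      using ex_reduced_word[OF x] .
    have "wp (xs @ [i]) = x \<otimes> s i" using xs i c by (simp add: wp_append)
    then obtain as j bs where d: "xs @ [i] = as @ j # bs" "wp (as @ bs) = y \<otimes> s i"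
      using strong_exchange[of "xs @ [i]" ?r] r less ys xs(1) i
      by (metis append_in_lists_conv lists.Cons lists.Nil)
    show False
    proof (cases bs rule: rev_cases)
      case Nil
      then have "x = y \<otimes> s i" using d xs by auto
      then show False using ne s_cancel_right i c by metis
    next
      case (snoc bs' k)
      then have d': "xs = as @ j # bs'" "k = i" using d by auto
      then have l: "as @ bs' \<in> lists I" using xs by auto
      then have "wp (as @ bs') \<otimes> s i = y \<otimes> s i"
        using d d' snoc wp_append[of "as @ bs'" "[i]"] i c by simp
      then have "wp (as @ bs') = y" using l c by simp
      then have "len y \<le> length (as @ bs')" using len_le l by metis
      then show False using d' xs t by simp
    qed
  qed
  moreover have "even (len (y \<otimes> s i)) \<longleftrightarrow> odd (len (x \<otimes> s i))"
    using len_reflection_parity[of "x \<otimes> s i" ?r] r x c by (simp only: ys m_closed)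
  then have "len (y \<otimes> s i) \<noteq> len (x \<otimes> s i)" by metis
  ultimately have "len (x \<otimes> s i) < len (y \<otimes> s i)" by simp
  moreover have "x \<otimes> s i \<in> carrier W" using x c by simp
  ultimately show ?thesis using r ys[symmetric] unfolding bruhat_edge_def by blast
qed

lemma right_descents_iff:
  "i \<in> right_descents W I s w \<longleftrightarrow> i \<in> I \<and> len (w \<otimes> s i) < len w"
  by (simp add: right_descents_def)

lemma ascent_edge:
  assumes "i \<in> I" "w \<in> carrier W" "i \<notin> right_descents W I s w"
  shows "bruhat_edge w (w \<otimes> s i)"
proof -
  have "len (w \<otimes> s i) \<noteq> len w"
    using len_reflection_parity[of w "s i"] assms s_reflection by auto
  then show ?thesis
    using assms s_reflection unfolding bruhat_edge_def by (auto simp: right_descents_iff)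
qed

lemma descent_edge:
  assumes "w \<in> carrier W" "i \<in> right_descents W I s w"
  shows "bruhat_edge (w \<otimes> s i) w"
  using assms s_reflection[of i] s_closed[of i] s_cancel_right[of i w]
  unfolding bruhat_edge_def right_descents_iff by (auto intro!: bexI[of _ "s i"])

lemma descent_mult_s:
  assumes "i \<in> I" "w \<in> carrier W"
  shows "i \<in> right_descents W I s (w \<otimes> s i) \<longleftrightarrow> i \<notin> right_descents W I s w"
  using ascent_edge[OF assms] descent_edge[OF assms(2), of i] assms
  by (auto simp: right_descents_iff s_cancel_right bruhat_edge_def)

text \<open>
  Monotonicity for one edge. If \<open>s\<^sub>i\<close> swaps the ends of the edge, each generator sends both ends to
  the same element. Otherwise \<open>x s\<^sub>i \<rightarrow> y s\<^sub>i\<close> is also an edge, and the images are joined by this edge or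
  the given one, followed or preceded by an edge \<open>w \<rightarrow> w s\<^sub>i\<close> if the descents of \<open>x\<close> and \<open>y\<close> at \<open>i\<close>
  differ.
\<close>

lemma hecke_pi_edge:
  assumes e: "bruhat_edge x y" and i: "i \<in> I"
  shows "bruhat_chain (hecke_pi W I s i x) (hecke_pi W I s i y)"
    and "bruhat_chain (hecke_pi_bar W I s i x) (hecke_pi_bar W I s i y)"
proof -
  have c: "x \<in> carrier W" "y \<in> carrier W" using bruhat_edge_closed[OF e] by auto
  have "bruhat_chain (hecke_pi W I s i x) (hecke_pi W I s i y) \<and>
    bruhat_chain (hecke_pi_bar W I s i x) (hecke_pi_bar W I s i y)"
  proof (cases "y = x \<otimes> s i")
    case True
    have "i \<notin> right_descents W I s x" using e True by (simp add: bruhat_edge_def right_descents_iff)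
    then show ?thesis
      using True c i descent_mult_s[of i x] s_cancel_right[of i x]
      by (simp add: hecke_pi_def hecke_pi_bar_def)
  next
    case False
    note e' = bruhat_edge_mult[OF e i False]
    note up = ascent_edge[OF i c(1)] ascent_edge[OF i c(2)]
    note down = descent_edge[OF c(1), of i] descent_edge[OF c(2), of i]
    show ?thesis
      using e e' up down c
      by (cases "i \<in> right_descents W I s x"; cases "i \<in> right_descents W I s y")
        (simp_all add: hecke_pi_def hecke_pi_bar_def,
          (meson r_into_rtranclp converse_rtranclp_into_rtranclp)+)
  qed
  then show "bruhat_chain (hecke_pi W I s i x) (hecke_pi W I s i y)"
    and "bruhat_chain (hecke_pi_bar W I s i x) (hecke_pi_bar W I s i y)" by auto
qed

lemma bruhat_chain_map:
  assumes "\<And>x y. bruhat_edge x y \<Longrightarrow> bruhat_chain (f x) (f y)" "bruhat_chain x y"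
  shows "bruhat_chain (f x) (f y)"
  using assms(2)
proof (induction rule: rtranclp_induct)
  case (step y z)
  then show ?case using assms(1)[of y z] by (meson rtranclp_trans)
qed simp

text \<open>
  Build the word letter by letter from the left. As the word is reduced, appending \<open>i\<close> applies
  \<open>\<pi>\<^sub>i\<close> to its product; if the subword also receives the letter, its product becomes its image
  under \<open>\<pi>\<^sub>i\<close> or goes down, so monotonicity of \<open>\<pi>\<^sub>i\<close> gives the step. The subword may be
  non-reduced, which is what is needed for the subwords produced by a biHecke element.
\<close>

lemma subword_bruhat_chain:
  "ys \<in> lists I \<Longrightarrow> length ys = len (wp ys) \<Longrightarrow> subseq xs ys \<Longrightarrow> bruhat_chain (wp xs) (wp ys)"
proof (induction ys arbitrary: xs rule: rev_induct)
  case Nil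
  then have "xs = []" by (cases xs) auto
  then show ?case by simp
next
  case (snoc i ys)
  then have i: "i \<in> I" "ys \<in> lists I" by auto
  have e: "wp (ys @ [i]) = wp ys \<otimes> s i" using i s_closed by (simp add: wp_append)
  have "len (wp (ys @ [i])) \<le> Suc (len (wp ys))"
    using len_mult_s_le i e by simp
  then have len: "length ys = len (wp ys)" using snoc len_le[OF i(2)] by simp
  then have asc: "i \<notin> right_descents W I s (wp ys)"
    using snoc e by (simp add: right_descents_iff)
  have edge: "bruhat_edge (wp ys) (wp (ys @ [i]))"
    using ascent_edge[OF i(1) _ asc] i e by simp
  show ?case
  proof (cases "subseq xs ys")
    case True
    then show ?thesis using snoc.IH[OF i(2) len True] edge by simp
  next
    case False
    then obtain xs' where xs': "xs = xs' @ [i]" "subseq xs' ys"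
    proof -
      obtain as bs where ab: "xs = as @ bs" "subseq as ys" "subseq bs [i]"
        using snoc.prems(3) subseq_append_iff[of xs ys "[i]"] by blast
      have "bs = [] \<or> bs = [i]"
        using ab(3) by (cases bs) (auto split: if_splits)
      then show thesis using that[of as] ab False by auto
    qed
    have l: "xs' \<in> lists I" using xs' i subword_lists by blast
    have ex: "wp xs = wp xs' \<otimes> s i" using xs' l i s_closed by (simp add: wp_append)
    have ch: "bruhat_chain (wp xs') (wp ys)" using snoc.IH[OF i(2) len] xs' by blast
    show ?thesis
    proof (cases "i \<in> right_descents W I s (wp xs')")
      case True
      then have "bruhat_edge (wp xs) (wp xs')" using descent_edge l ex by simp
      then show ?thesis using ch edge by (meson converse_rtranclp_into_rtranclp rtranclp.rtrancl_into_rtrancl)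
    next
      case False
      have "bruhat_chain (hecke_pi W I s i (wp xs')) (hecke_pi W I s i (wp ys))"
        using bruhat_chain_map[of "hecke_pi W I s i"] hecke_pi_edge(1) ch i by blast
      then show ?thesis using False asc l i e ex by (simp add: hecke_pi_def)
    qed
  qed
qed

lemma bruhat_le_iff_chain:
  assumes "x \<in> carrier W" "y \<in> carrier W"
  shows "bruhat_le W I s x y \<longleftrightarrow> bruhat_chain x y"
proof
  assume "bruhat_le W I s x y"
  then show "bruhat_chain x y"
    using subword_bruhat_chain unfolding bruhat_le_def reduced_word_def by blast
next
  assume ch: "bruhat_chain x y"
  obtain ys where ys: "ys \<in> lists I" "wp ys = y" "length ys = len y"
    using ex_reduced_word[OF assms(2)] .
  obtain zs where zs: "subseq zs ys" "wp zs = x"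
    using bruhat_chain_subword[of x ys] ch ys by auto
  obtain xs where "subseq xs zs" "reduced_word W I s xs x"
    using ex_reduced_subword[of zs] zs subword_lists[OF zs(1) ys(1)] by auto
  then show "bruhat_le W I s x y"
    using ys zs(1) subseq_order.order_trans unfolding bruhat_le_def reduced_word_def by metis
qed

section \<open>The biHecke monoid\<close>

lemma hecke_pi_closed:
  assumes "i \<in> I" "w \<in> carrier W"
  shows "hecke_pi W I s i w \<in> carrier W" "hecke_pi_bar W I s i w \<in> carrier W"
  using assms s_closed by (auto simp: hecke_pi_def hecke_pi_bar_def)

lemma bihecke_extensional: "f \<in> bihecke_set W I s \<Longrightarrow> f \<in> extensional (carrier W)"
  by (induction rule: bihecke_set.induct)
    (simp_all only: hecke_pi_def hecke_pi_bar_def rcomp_def restrict_extensional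
      compose_extensional)

lemma bihecke_closed: "f \<in> bihecke_set W I s \<Longrightarrow> w \<in> carrier W \<Longrightarrow> f w \<in> carrier W"
  by (induction arbitrary: w rule: bihecke_set.induct)
    (auto simp: hecke_pi_closed rcomp_def compose_def)

lemma bruhat_chain_closed: "bruhat_chain x y \<Longrightarrow> x \<in> carrier W \<Longrightarrow> y \<in> carrier W"
  by (induction rule: rtranclp_induct) (auto dest: bruhat_edge_closed)

lemma bihecke_mono:
  assumes "f \<in> bihecke_set W I s" "x \<in> carrier W" "bruhat_chain x y"
  shows "bruhat_chain (f x) (f y)"
  using assms
proof (induction arbitrary: x y rule: bihecke_set.induct)
  case one
  then show ?case using bruhat_chain_closed by auto
next
  case (pi i)
  then show ?case using bruhat_chain_map hecke_pi_edge(1) by blast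
next
  case (pi_bar i)
  then show ?case using bruhat_chain_map hecke_pi_edge(2) by blast
next
  case (mult f g)
  then show ?case
    using bruhat_chain_closed bihecke_closed by (simp add: rcomp_def compose_def)
qed

text \<open>
  If \<open>s\<^sub>i\<close> lengthens \<open>w\<close> but shortens \<open>s\<^sub>j w\<close>, exchange in the word \<open>j\<close> followed by a reduced word of
  \<open>w\<close> can only delete the \<open>j\<close>, which says \<open>s\<^sub>j w s\<^sub>i = w\<close>.
\<close>

lemma ascent_descent_commute:
  assumes "i \<in> I" "j \<in> I" "w \<in> carrier W"
    and asc: "i \<notin> right_descents W I s w" and desc: "i \<in> right_descents W I s (s j \<otimes> w)"
  shows "s j \<otimes> w = w \<otimes> s i"
proof -
  have c: "s i \<in> carrier W" "s j \<in> carrier W" using assms s_closed by auto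
  obtain xs where xs: "xs \<in> lists I" "wp xs = w" "length xs = len w"
    using ex_reduced_word[OF assms(3)] .
  then obtain as k bs where d: "j # xs = as @ k # bs" "wp (as @ bs) = s j \<otimes> w \<otimes> s i"
    using strong_exchange[of "j # xs" "s i"] desc assms s_reflection
    by (auto simp: right_descents_iff)
  show ?thesis
  proof (cases as)
    case Nil
    then have "w = s j \<otimes> w \<otimes> s i" using d xs by simp
    then have "w \<otimes> s i = s j \<otimes> w \<otimes> s i \<otimes> s i" by simp
    then show ?thesis using assms c by (simp add: s_cancel_right)
  next
    case (Cons j' as')
    then have d': "xs = as' @ k # bs" "j' = j" using d by auto
    then have l: "as' @ bs \<in> lists I" using xs by auto
    have "s j \<otimes> wp (as' @ bs) = s j \<otimes> (w \<otimes> s i)"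
      using d d' Cons assms c by (simp add: m_assoc)
    then have "wp (as' @ bs) = w \<otimes> s i" using l c assms by simp
    then have "len (w \<otimes> s i) \<le> length (as' @ bs)" using len_le l by metis
    then show ?thesis using asc d' xs assms(1) by (simp add: right_descents_iff)
  qed
qed

lemma descents_differ_commute:
  assumes "i \<in> I" "j \<in> I" "w \<in> carrier W"
    and "(i \<in> right_descents W I s w) \<noteq> (i \<in> right_descents W I s (s j \<otimes> w))"
  shows "s j \<otimes> w = w \<otimes> s i"
proof (cases "i \<in> right_descents W I s w")
  case False
  then show ?thesis using ascent_descent_commute assms by blast
next
  case True
  have c: "s j \<otimes> w \<in> carrier W" using assms s_closed by simp
  have "s j \<otimes> (s j \<otimes> w) = s j \<otimes> w \<otimes> s i"
    using ascent_descent_commute[OF assms(1,2) c] True assms s_cancel_left by simp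
  then have "w \<otimes> s i = s j \<otimes> w \<otimes> s i \<otimes> s i" using s_cancel_left assms by simp
  then show ?thesis using s_cancel_right assms(1) c by simp
qed

text \<open>
  When the descents of \<open>w\<close> and \<open>s\<^sub>j w\<close> at \<open>i\<close> agree, a generator multiplies both by the same element on
  the right; when they differ, \<open>w\<close> and \<open>s\<^sub>j w = w s\<^sub>i\<close> form one coset of \<open>s\<^sub>i\<close>, which each of
  \<open>\<pi>\<^sub>i\<close> and its counterpart collapses to a point.
\<close>

lemma bihecke_left_step:
  assumes "f \<in> bihecke_set W I s" "w \<in> carrier W" "j \<in> I"
  shows "f (s j \<otimes> w) = f w \<or> f (s j \<otimes> w) = s j \<otimes> f w"
  using assms
proof (induction arbitrary: w rule: bihecke_set.induct)
  case one
  then show ?case using s_closed by simp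
next
  case (pi i)
  then show ?case
    using descents_differ_commute[of i j w] s_closed[of i] s_closed[of j]
      s_cancel_right[of i w]
    by (auto simp: hecke_pi_def m_assoc[symmetric])
next
  case (pi_bar i)
  then show ?case
    using descents_differ_commute[of i j w] s_closed[of i] s_closed[of j]
      s_cancel_right[of i w]
    by (auto simp: hecke_pi_bar_def m_assoc[symmetric])
next
  case (mult f g)
  have c: "s j \<otimes> w \<in> carrier W" "f w \<in> carrier W"
    using mult s_closed bihecke_closed by auto
  have "f (s j \<otimes> w) = f w \<or> f (s j \<otimes> w) = s j \<otimes> f w" using mult by blast
  then show ?case
    using mult.IH(2)[OF c(2) mult.prems(2)] c mult.prems by (auto simp: rcomp_def compose_def)
qed

lemma bihecke_subword:
  assumes "f \<in> bihecke_set W I s" "f \<one> = \<one>" "xs \<in> lists I"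
  shows "\<exists>ys. subseq ys xs \<and> f (wp xs) = wp ys"
  using assms(3)
proof (induction xs)
  case Nil
  then show ?case using assms by (intro exI[of _ "[]"]) simp
next
  case (Cons i xs)
  then obtain ys where ys: "subseq ys xs" "f (wp xs) = wp ys" by auto
  have "f (wp (i # xs)) = wp ys \<or> f (wp (i # xs)) = wp (i # ys)"
    using bihecke_left_step[OF assms(1), of "wp xs" i] Cons ys by auto
  moreover have "subseq ys (i # xs)" "subseq (i # ys) (i # xs)"
    using ys(1) by (auto intro: list_emb_Cons)
  ultimately show ?case by metis
qed

lemma bihecke_regressive:
  assumes "f \<in> bihecke_set W I s" "f \<one> = \<one>" "w \<in> carrier W"
  shows "bruhat_chain (f w) w"
proof -
  obtain xs where xs: "xs \<in> lists I" "wp xs = w" "length xs = len w"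
    using ex_reduced_word[OF assms(3)] .
  obtain ys where "subseq ys xs" "f w = wp ys"
    using bihecke_subword[OF assms(1,2) xs(1)] xs(2) by auto
  then show ?thesis using subword_bruhat_chain[of xs ys] xs by simp
qed

section \<open>The Borel submonoid\<close>

lemma borel_iff: "f \<in> borel_submonoid W I s \<longleftrightarrow> f \<in> bihecke_set W I s \<and> f \<one> = \<one>"
  by (simp add: borel_submonoid_def bihecke_monoid_def)

lemma borel_order_iff:
  "(f, g) \<in> borel_order W I s \<longleftrightarrow>
    f \<in> borel_submonoid W I s \<and> g \<in> borel_submonoid W I s \<and>
    (\<forall>w \<in> carrier W. bruhat_chain (f w) (g w))"
  using bihecke_closed by (auto simp: borel_order_def borel_iff bruhat_le_iff_chain)

lemma borel_order_partial_order:
  "partial_order_on (borel_submonoid W I s) (borel_order W I s)"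
  unfolding partial_order_on_def preorder_on_def
proof (intro conjI)
  show "borel_order W I s \<subseteq> borel_submonoid W I s \<times> borel_submonoid W I s"
    by (auto simp: borel_order_iff)
  show "refl_on (borel_submonoid W I s) (borel_order W I s)"
    by (auto simp: refl_on_def borel_order_iff)
  show "trans (borel_order W I s)"
    by (rule transI) (auto simp: borel_order_iff intro: rtranclp_trans)
  show "antisym (borel_order W I s)"
  proof (rule antisymI)
    fix f g
    assume fg: "(f, g) \<in> borel_order W I s" "(g, f) \<in> borel_order W I s"
    then have "f w = g w" if "w \<in> carrier W" for w
    proof -
      have "bruhat_chain (f w) (g w)" "bruhat_chain (g w) (f w)"
        using fg that by (auto simp: borel_order_iff)
      then show ?thesis using bruhat_chain_len[of "f w"] bruhat_chain_len[of "g w"] by force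
    qed
    moreover have "f \<in> extensional (carrier W)" "g \<in> extensional (carrier W)"
      using fg bihecke_extensional by (auto simp: borel_order_iff borel_iff)
    ultimately show "f = g" using extensionalityI by blast
  qed
qed

lemma borel_mult_le:
  assumes "f \<in> borel_submonoid W I s" "g \<in> borel_submonoid W I s"
  shows "(rcomp W f g, f) \<in> borel_order W I s" "(rcomp W f g, g) \<in> borel_order W I s"
proof -
  have f: "f \<in> bihecke_set W I s" "f \<one> = \<one>" and g: "g \<in> bihecke_set W I s" "g \<one> = \<one>"
    using assms by (auto simp: borel_iff)
  have app: "rcomp W f g w = g (f w)" if "w \<in> carrier W" for w
    using that by (simp add: rcomp_def compose_def)
  have fg: "rcomp W f g \<in> borel_submonoid W I s"
    using f g app by (simp add: borel_iff bihecke_set.mult)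
  show "(rcomp W f g, f) \<in> borel_order W I s"
    using fg assms app bihecke_regressive[OF g] bihecke_closed[OF f(1)]
    by (simp add: borel_order_iff)
  show "(rcomp W f g, g) \<in> borel_order W I s"
    using fg assms app bihecke_mono[OF g(1)] bihecke_regressive[OF f] bihecke_closed[OF f(1)]
    by (simp add: borel_order_iff)
qed

end

theorem corollary4p2:
  fixes W :: "('a, 'b) monoid_scheme"
    and I :: "'i set" and s :: "'i \<Rightarrow> 'a" and m :: "'i \<Rightarrow> 'i \<Rightarrow> nat"
  assumes "coxeter_system W I s m"
    and "finite (carrier W)"
  shows "partial_order_on (borel_submonoid W I s) (borel_order W I s) \<and>
    (\<forall>f \<in> borel_submonoid W I s. \<forall>g \<in> borel_submonoid W I s.
       (f \<otimes>\<^bsub>bihecke_monoid W I s\<^esub> g, f) \<in> borel_order W I s \<and>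
       (f \<otimes>\<^bsub>bihecke_monoid W I s\<^esub> g, g) \<in> borel_order W I s)"
proof -
  interpret coxeter_system W I s m by (rule assms(1))
  show ?thesis
    using borel_order_partial_order borel_mult_le by (simp add: bihecke_monoid_def)
qed

end
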